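(* Let $s,\ell\ge1$. For $t\in\{1,\dots,s\}$ let $\mathscr{B}_t\subseteq\mathbb{R}^2$ be a set of points $(y_t,z_t)$ with $z_t>0$, let $\mathscr{B}=\mathscr{B}_1\times\dots\times\mathscr{B}_s$ (points written $(\mathbf{y},\mathbf{z})$), and let $b_{t0}<b_{t1}<\dots<b_{t\ell}$ be breakpoints with $b_{t0}\le y_t/z_t<b_{t\ell}$ for all $(y_t,z_t)\in\mathscr{B}_t$. Let $\phi:\mathbb{R}\to\mathbb{R}$ be increasing, and let $\psi:\mathscr{B}\to\mathbb{R}$, $\psi(\mathbf{y},\mathbf{z})=\phi\left(\sum_{t=1}^s\frac{y_t}{z_t}\right)$. If the constants $\mathscr{M}_{tk}$, $\mathscr{N}_{\mathbf{k}}$ are sufficiently large, then $\operatorname{proj}_{(\mathbf{y},\mathbf{z},f)}\left(\widehat{\operatorname{step}}^{\,s}_{\{b_{tk}\}}(\psi)\right)$ is an $\varepsilon$-relaxation of $\operatorname{hyp}(\psi)$ with $$\operatorname{hyp}(\psi)\subseteq\operatorname{proj}_{(\mathbf{y},\mathbf{z},f)}\left(\widehat{\operatorname{step}}^{\,s}_{\{b_{tk}\}}(\psi)\right)\quad\text{and}\quad\varepsilon=\max_{(k_1,\dots,k_s)\in\{0,\dots,\ell-1\}^s}\left\{\phi\left(\sum_{t=1}^sb_{t,k_t+1}\right)-\phi\left(\sum_{t=1}^sb_{t,k_t}\right)\right\}.$$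
   Context: $\widehat{\operatorname{step}}^{\,s}_{\{b_{tk}\}}(\psi)$ is the set of $((\mathbf{y},\mathbf{z}),f,\boldsymbol\delta)\in\mathscr{B}\times\mathbb{R}\times\{0,1\}^{s\times\ell}$ such that $$f-\phi\left(\sum_{t=1}^sb_{t,k_t}\right)\le\mathscr{N}_{\mathbf{k}}\sum_{t=1}^s(1-\delta_{t,k_t})\quad\forall\mathbf{k}=(k_1,\dots,k_s)\in\{1,\dots,\ell\}^s,$$ $$b_{tk}z_t-y_t\le\mathscr{M}_{tk}\delta_{tk}\quad\forall t\in\{1,\dots,s\},\ k\in\{1,\dots,\ell\},$$ $$\delta_{t,k-1}\le\delta_{tk}\quad\forall t\in\{1,\dots,s\},\ k\in\{2,\dots,\ell\}.$$ "Sufficiently large" means $\mathscr{N}_{\mathbf{k}}\ge\phi\left(\sum_tb_{t\ell}\right)-\phi\left(\sum_tb_{t,k_t}\right)$ for all $\mathbf{k}$, and $\mathscr{M}_{tk}\ge b_{tk}z_t-y_t$ for all $(y_t,z_t)\in\mathscr{B}_t$ and all $t,k$. $\operatorname{hyp}(\psi)=\{(\mathbf{y},\mathbf{z},f)\in\mathscr{B}\times\mathbb{R}:f\le\psi(\mathbf{y},\mathbf{z})\}$, and $\operatorname{proj}_{(\mathbf{y},\mathbf{z},f)}$ discards $\boldsymbol\delta$. A set $\mathscr{R}\supseteq\mathscr{H}$ is an $\varepsilon$-relaxation of $\mathscr{H}$ if for every $(\mathbf{y},\mathbf{z},f)\in\mathscr{R}$ there is $f'\ge f-\varepsilon$ with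 $(\mathbf{y},\mathbf{z},f')\in\mathscr{H}$. *)

theory Defs
  imports "HOL-Analysis.Analysis"
begin

text \<open>
  The index set of \<open>t\<close> is a finite type \<open>'s\<close>, so the dimension \<open>s\<close> is \<open>CARD('s)\<close>. Vectors
  \<open>(y, z)\<close> live in \<open>(real^'s) \<times> (real^'s)\<close>. Multi-indices are functions \<open>'s \<Rightarrow> nat\<close>, and the index
  \<open>k\<close> is a natural number with explicit bounds.
\<close>

definition prod_domain :: "('s \<Rightarrow> (real \<times> real) set) \<Rightarrow> ((real^'s) \<times> (real^'s)) set" where
  "prod_domain B = {(y, z). \<forall>t. (y $ t, z $ t) \<in> B t}"

definition sum_of_ratios :: "(real \<Rightarrow> real) \<Rightarrow> (real^'s) \<times> (real^'s) \<Rightarrow> real" where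
  "sum_of_ratios \<phi> = (\<lambda>(y, z). \<phi> (\<Sum>t\<in>UNIV. y $ t / z $ t))"

definition hypograph :: "'a set \<Rightarrow> ('a \<Rightarrow> real) \<Rightarrow> ('a \<times> real) set" where
  "hypograph D \<psi> = {(x, f). x \<in> D \<and> f \<le> \<psi> x}"

definition is_relaxation :: "real \<Rightarrow> ('a \<times> real) set \<Rightarrow> ('a \<times> real) set \<Rightarrow> bool" where
  "is_relaxation \<epsilon> R H \<longleftrightarrow>
     H \<subseteq> R \<and> (\<forall>(x, f)\<in>R. \<exists>f'. f' \<ge> f - \<epsilon> \<and> (x, f') \<in> H)"

text \<open>
  The extensional function space makes the set of binary arrays \<open>\<delta>\<close> exactly
  \<open>{0,1}\<close> to the power \<open>s \<times> l\<close>: values \<open>\<delta> t k\<close> with \<open>k\<close> outside \<open>{1..l}\<close> are fixed.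
\<close>

definition step_set ::
  "nat \<Rightarrow> ('s \<Rightarrow> (real \<times> real) set) \<Rightarrow> ('s \<Rightarrow> nat \<Rightarrow> real) \<Rightarrow> (real \<Rightarrow> real)
   \<Rightarrow> ('s \<Rightarrow> nat \<Rightarrow> real) \<Rightarrow> (('s \<Rightarrow> nat) \<Rightarrow> real)
   \<Rightarrow> (((real^'s) \<times> (real^'s)) \<times> real \<times> ('s \<Rightarrow> nat \<Rightarrow> real)) set" where
  "step_set l B b \<phi> M N =
     {((y, z), f, \<delta>).
        (y, z) \<in> prod_domain B \<and>
        \<delta> \<in> UNIV \<rightarrow>\<^sub>E ({1..l} \<rightarrow>\<^sub>E {0, 1}) \<and>
        (\<forall>k \<in> UNIV \<rightarrow>\<^sub>E {1..l}.
           f - \<phi> (\<Sum>t\<in>UNIV. b t (k t)) \<le> N k * (\<Sum>t\<in>UNIV. 1 - \<delta> t (k t))) \<and>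
        (\<forall>t. \<forall>k\<in>{1..l}. b t k * z $ t - y $ t \<le> M t k * \<delta> t k) \<and>
        (\<forall>t. \<forall>k\<in>{2..l}. \<delta> t (k - 1) \<le> \<delta> t k)}"

definition proj_yzf :: "('a \<times> real \<times> 'd) set \<Rightarrow> ('a \<times> real) set" where
  "proj_yzf S = (\<lambda>(x, f, \<delta>). (x, f)) ` S"

definition sufficiently_large ::
  "nat \<Rightarrow> ('s::finite \<Rightarrow> (real \<times> real) set) \<Rightarrow> ('s \<Rightarrow> nat \<Rightarrow> real) \<Rightarrow> (real \<Rightarrow> real)
   \<Rightarrow> ('s \<Rightarrow> nat \<Rightarrow> real) \<Rightarrow> (('s \<Rightarrow> nat) \<Rightarrow> real) \<Rightarrow> bool" where
  "sufficiently_large l B b \<phi> M N \<longleftrightarrow>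
     (\<forall>k \<in> UNIV \<rightarrow>\<^sub>E {1..l}.
        N k \<ge> \<phi> (\<Sum>t\<in>UNIV. b t l) - \<phi> (\<Sum>t\<in>UNIV. b t (k t))) \<and>
     (\<forall>t. \<forall>k\<in>{1..l}. \<forall>(y, z)\<in>B t. M t k \<ge> b t k * z - y)"

definition max_gap :: "nat \<Rightarrow> ('s::finite \<Rightarrow> nat \<Rightarrow> real) \<Rightarrow> (real \<Rightarrow> real) \<Rightarrow> real" where
  "max_gap l b \<phi> =
     Max ((\<lambda>k. \<phi> (\<Sum>t\<in>UNIV. b t (k t + 1)) - \<phi> (\<Sum>t\<in>UNIV. b t (k t)))
            ` (UNIV \<rightarrow>\<^sub>E {0..l - 1}))"

end

theory Submission
  imports Defs
begin

text \<open>
  The binary \<open>\<delta> t k\<close> encodes whether the ratio \<open>y\<^sub>t / z\<^sub>t\<close> lies below the breakpoint \<open>b t k\<close>.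

  \<^item> Every point of the hypograph lifts: take \<open>\<delta>\<close> to be exactly these indicators. Where all selected
    binaries are \<open>1\<close>, the selected breakpoints exceed the ratios, so monotonicity of \<open>\<phi>\<close> bounds \<open>f\<close>.
    Where some selected binary is \<open>0\<close>, the right-hand side is at least \<open>N k\<close>, which covers the largest
    possible violation, because all ratios lie below the last breakpoints.
  \<^item> Conversely, a feasible \<open>\<delta>\<close> has \<open>\<delta> t l = 1\<close>, since the ratio is strictly below \<open>b t l\<close>. Let
    \<open>k t\<close> be the first index in \<open>{1..l}\<close> at which \<open>\<delta> t\<close> is \<open>1\<close>. The ratio is then at least
    \<open>b t (k t - 1)\<close>, while the first family of constraints gives \<open>f \<le> \<phi> (\<Sum>t. b t (k t))\<close>. The two
    values of \<open>\<phi>\<close> belong to opposite corners of one cell of the grid of breakpoints, and the excess of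
    \<open>f\<close> over the function is at most the increase of \<open>\<phi>\<close> across that cell, hence at most the maximal
    gap.
\<close>

lemma hypograph_subset_proj_step_set:
  fixes B :: "'s::finite \<Rightarrow> (real \<times> real) set"
  assumes pos: "\<And>t y z. (y, z) \<in> B t \<Longrightarrow> z > 0"
    and below_last: "\<And>t y z. (y, z) \<in> B t \<Longrightarrow> y / z < b t l"
    and b_mono: "\<And>t k. k \<in> {1..l} \<Longrightarrow> b t k \<le> b t l"
    and step_mono: "\<And>t k. k \<in> {2..l} \<Longrightarrow> b t (k - 1) \<le> b t k"
    and \<phi>: "mono \<phi>"
    and large: "sufficiently_large l B b \<phi> M N"
  shows "hypograph (prod_domain B) (sum_of_ratios \<phi>) \<subseteq> proj_yzf (step_set l B b \<phi> M N)"
proof clarify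
  fix y z :: "real^'s" and f :: real
  assume "((y, z), f) \<in> hypograph (prod_domain B) (sum_of_ratios \<phi>)"
  then have dom: "(y, z) \<in> prod_domain B" and f: "f \<le> \<phi> (\<Sum>t\<in>UNIV. y $ t / z $ t)"
    by (auto simp: hypograph_def sum_of_ratios_def)
  have B: "(y $ t, z $ t) \<in> B t" for t
    using dom by (simp add: prod_domain_def)
  define \<delta> :: "'s \<Rightarrow> nat \<Rightarrow> real"
    where "\<delta> t = (\<lambda>k\<in>{1..l}. if y $ t / z $ t < b t k then 1 else 0)" for t
  have "f - \<phi> (\<Sum>t\<in>UNIV. b t (k t)) \<le> N k * (\<Sum>t\<in>UNIV. 1 - \<delta> t (k t))"
    if k: "k \<in> UNIV \<rightarrow>\<^sub>E {1..l}" for k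
  proof -
    have kt: "k t \<in> {1..l}" for t
      using k by auto
    have \<delta>_le: "\<delta> t (k t) \<le> 1" for t
      using kt[of t] by (simp add: \<delta>_def)
    show ?thesis
    proof (cases "\<forall>t. y $ t / z $ t < b t (k t)")
      case True
      then have "f \<le> \<phi> (\<Sum>t\<in>UNIV. b t (k t))"
        using f monoD[OF \<phi>, OF sum_mono, of UNIV "\<lambda>t. y $ t / z $ t" "\<lambda>t. b t (k t)"]
        by (meson less_imp_le order_trans)
      moreover have "\<delta> t (k t) = 1" for t
        using True kt[of t] by (simp add: \<delta>_def)
      ultimately show ?thesis
        by simp
    next
      case False
      then obtain u where "\<not> y $ u / z $ u < b u (k u)"
        by blast
      then have "1 - \<delta> u (k u) = 1"
        using kt[of u] by (simp add: \<delta>_def)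
      then have ge1: "1 \<le> (\<Sum>t\<in>UNIV. 1 - \<delta> t (k t))"
        using member_le_sum[of u UNIV "\<lambda>t. 1 - \<delta> t (k t)"] \<delta>_le by simp
      have N: "\<phi> (\<Sum>t\<in>UNIV. b t l) - \<phi> (\<Sum>t\<in>UNIV. b t (k t)) \<le> N k"
        using large k by (simp add: sufficiently_large_def)
      have "\<phi> (\<Sum>t\<in>UNIV. b t (k t)) \<le> \<phi> (\<Sum>t\<in>UNIV. b t l)"
        by (intro monoD[OF \<phi>] sum_mono b_mono kt)
      then have "N k * 1 \<le> N k * (\<Sum>t\<in>UNIV. 1 - \<delta> t (k t))"
        using N ge1 by (intro mult_left_mono) auto
      moreover have "\<phi> (\<Sum>t\<in>UNIV. y $ t / z $ t) \<le> \<phi> (\<Sum>t\<in>UNIV. b t l)"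
        by (intro monoD[OF \<phi>] sum_mono less_imp_le below_last B)
      ultimately show ?thesis
        using f N by linarith
    qed
  qed
  moreover have "b t k * z $ t - y $ t \<le> M t k * \<delta> t k" if k: "k \<in> {1..l}" for t k
  proof (cases "y $ t / z $ t < b t k")
    case True
    have "b t k * z $ t - y $ t \<le> M t k"
      using large k B[of t] by (fastforce simp: sufficiently_large_def)
    then show ?thesis
      using True k by (simp add: \<delta>_def)
  next
    case False
    then show ?thesis
      using pos[OF B[of t]] k by (simp add: \<delta>_def field_simps)
  qed
  moreover have "\<delta> t (k - 1) \<le> \<delta> t k" if k: "k \<in> {2..l}" for t k
    using step_mono[OF k, of t] k by (auto simp: \<delta>_def)
  moreover have "\<delta> \<in> UNIV \<rightarrow>\<^sub>E ({1..l} \<rightarrow>\<^sub>E {0, 1})"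
    by (auto simp: \<delta>_def split: if_splits)
  ultimately have "((y, z), f, \<delta>) \<in> step_set l B b \<phi> M N"
    using dom by (simp add: step_set_def)
  then show "((y, z), f) \<in> proj_yzf (step_set l B b \<phi> M N)"
    by (force simp: proj_yzf_def)
qed

text \<open>
  A feasible array of binaries locates the vector of ratios above the lower corner of some grid cell
  whose upper corner bounds \<open>f\<close>. The cell may lie strictly below the one that contains the ratios:
  the constraints force \<open>\<delta> t k = 1\<close> when the ratio is below \<open>b t k\<close>, but need not
  forbid it otherwise.
\<close>
lemma step_set_cell:
  fixes B :: "'s::finite \<Rightarrow> (real \<times> real) set"
  assumes l: "l \<ge> 1"
    and pos: "\<And>t y z. (y, z) \<in> B t \<Longrightarrow> z > 0"
    and range: "\<And>t y z. (y, z) \<in> B t \<Longrightarrow> b t 0 \<le> y / z \<and> y / z < b t l"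
    and step: "((y, z), f, \<delta>) \<in> step_set l B b \<phi> M N"
  obtains j where "j \<in> UNIV \<rightarrow>\<^sub>E {0..l - 1}"
    and "\<And>t. b t (j t) \<le> y $ t / z $ t"
    and "f \<le> \<phi> (\<Sum>t\<in>UNIV. b t (j t + 1))"
proof -
  have B: "(y $ t, z $ t) \<in> B t" for t
    using step by (simp add: step_set_def prod_domain_def)
  have "\<delta> \<in> UNIV \<rightarrow>\<^sub>E ({1..l} \<rightarrow>\<^sub>E {0, 1})"
    using step by (simp add: step_set_def)
  then have \<delta>: "\<delta> t k = 0 \<or> \<delta> t k = 1" if "k \<in> {1..l}" for t k
    using that by (auto simp: PiE_iff)
  have ratio_constraint: "b t k * z $ t - y $ t \<le> M t k * \<delta> t k" if "k \<in> {1..l}" for t k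
    using step that by (simp add: step_set_def)
  have zero_imp: "b t k \<le> y $ t / z $ t" if "k \<in> {1..l}" "\<delta> t k = 0" for t k
    using ratio_constraint[OF that(1), of t] that(2) pos[OF B[of t]] by (simp add: field_simps)
  have last: "\<delta> t l = 1" for t
    using \<delta>[of l t] zero_imp[of l t] range[OF B[of t]] l by fastforce
  define k where "k t = (LEAST i. i \<in> {1..l} \<and> \<delta> t i = 1)" for t
  have k: "k t \<in> {1..l} \<and> \<delta> t (k t) = 1" for t
    unfolding k_def by (rule LeastI[of _ l]) (use l last in auto)
  have below_k: "b t (k t - 1) \<le> y $ t / z $ t" for t
  proof (cases "k t = 1")
    case True
    then show ?thesis
      using range[OF B[of t]] by simp
  next
    case False
    then have mem: "k t - 1 \<in> {1..l}" and less: "k t - 1 < k t"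
      using k[of t] by auto
    have "\<delta> t (k t - 1) \<noteq> 1"
      using not_less_Least[of "k t - 1" "\<lambda>i. i \<in> {1..l} \<and> \<delta> t i = 1"] less mem
      unfolding k_def by blast
    then show ?thesis
      using \<delta>[OF mem] zero_imp[OF mem] by blast
  qed
  have "k \<in> UNIV \<rightarrow>\<^sub>E {1..l}"
    using k by auto
  then have "f - \<phi> (\<Sum>t\<in>UNIV. b t (k t)) \<le> N k * (\<Sum>t\<in>UNIV. 1 - \<delta> t (k t))"
    using step by (simp add: step_set_def)
  then have f: "f \<le> \<phi> (\<Sum>t\<in>UNIV. b t (k t))"
    using k by simp
  have Suc: "k t - 1 + 1 = k t" and le: "k t - 1 \<in> {0..l - 1}" for t
    using k[of t] by auto
  show ?thesis
  proof (rule that[of "\<lambda>t. k t - 1"])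
    show "(\<lambda>t. k t - 1) \<in> UNIV \<rightarrow>\<^sub>E {0..l - 1}"
      using le by (simp add: PiE_UNIV_domain)
    show "b t (k t - 1) \<le> y $ t / z $ t" for t
      by (rule below_k)
    show "f \<le> \<phi> (\<Sum>t\<in>UNIV. b t (k t - 1 + 1))"
      using f by (simp only: Suc)
  qed
qed

lemma cell_gap_le_max_gap:
  fixes b :: "'s::finite \<Rightarrow> nat \<Rightarrow> real"
  assumes "j \<in> UNIV \<rightarrow>\<^sub>E {0..l - 1}"
  shows "\<phi> (\<Sum>t\<in>UNIV. b t (j t + 1)) - \<phi> (\<Sum>t\<in>UNIV. b t (j t)) \<le> max_gap l b \<phi>"
  unfolding max_gap_def
  by (rule Max_ge) (use assms in \<open>simp_all add: finite_PiE\<close>)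

theorem proposition18:
  fixes l :: nat
    and B :: "'s::finite \<Rightarrow> (real \<times> real) set"
    and b :: "'s \<Rightarrow> nat \<Rightarrow> real"
    and \<phi> :: "real \<Rightarrow> real"
    and M :: "'s \<Rightarrow> nat \<Rightarrow> real"
    and N :: "('s \<Rightarrow> nat) \<Rightarrow> real"
  assumes "l \<ge> 1"
    and "\<And>t y z. (y, z) \<in> B t \<Longrightarrow> z > 0"
    and "\<And>t. strict_mono_on {0..l} (b t)"
    and "\<And>t y z. (y, z) \<in> B t \<Longrightarrow> b t 0 \<le> y / z \<and> y / z < b t l"
    and "mono \<phi>"
    and "sufficiently_large l B b \<phi> M N"
  shows "hypograph (prod_domain B) (sum_of_ratios \<phi>) \<subseteq> proj_yzf (step_set l B b \<phi> M N)
    \<and> is_relaxation (max_gap l b \<phi>)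
        (proj_yzf (step_set l B b \<phi> M N))
        (hypograph (prod_domain B) (sum_of_ratios \<phi>))"
proof (rule conjI)
  show lift: "hypograph (prod_domain B) (sum_of_ratios \<phi>) \<subseteq> proj_yzf (step_set l B b \<phi> M N)"
  proof (rule hypograph_subset_proj_step_set[OF assms(2) _ _ _ assms(5,6)])
    show "y / z < b t l" if "(y, z) \<in> B t" for t y z
      using assms(4)[OF that] by simp
    have b_le: "b t i \<le> b t k" if "i \<le> k" "k \<le> l" for t i k
      using strict_mono_on_leD[OF assms(3), of i k t] that by simp
    show "b t k \<le> b t l" if "k \<in> {1..l}" for t k
      using b_le that by simp
    show "b t (k - 1) \<le> b t k" if "k \<in> {2..l}" for t k
      using b_le that by simp
  qed
  show "is_relaxation (max_gap l b \<phi>)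
        (proj_yzf (step_set l B b \<phi> M N))
        (hypograph (prod_domain B) (sum_of_ratios \<phi>))"
    unfolding is_relaxation_def
  proof (intro conjI lift, clarify)
    fix y z :: "real^'s" and f :: real
    assume "((y, z), f) \<in> proj_yzf (step_set l B b \<phi> M N)"
    then obtain \<delta> where step: "((y, z), f, \<delta>) \<in> step_set l B b \<phi> M N"
      by (auto simp: proj_yzf_def)
    obtain j where j: "j \<in> UNIV \<rightarrow>\<^sub>E {0..l - 1}"
      and lower: "\<And>t. b t (j t) \<le> y $ t / z $ t"
      and upper: "f \<le> \<phi> (\<Sum>t\<in>UNIV. b t (j t + 1))"
      by (rule step_set_cell[OF assms(1) _ _ step]) (erule assms(2), erule assms(4), rule that)
    have "\<phi> (\<Sum>t\<in>UNIV. b t (j t)) \<le> sum_of_ratios \<phi> (y, z)"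
      unfolding sum_of_ratios_def prod.case by (intro monoD[OF assms(5)] sum_mono lower)
    then have "f - max_gap l b \<phi> \<le> sum_of_ratios \<phi> (y, z)"
      using upper cell_gap_le_max_gap[OF j, of \<phi> b] by linarith
    moreover have "((y, z), sum_of_ratios \<phi> (y, z)) \<in> hypograph (prod_domain B) (sum_of_ratios \<phi>)"
      using step by (simp add: hypograph_def step_set_def)
    ultimately show "\<exists>f'. f' \<ge> f - max_gap l b \<phi>
        \<and> ((y, z), f') \<in> hypograph (prod_domain B) (sum_of_ratios \<phi>)"
      by blast
  qed
qed

end
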